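(* Let $D\subset\mathbb{C}$ be a circular domain and let $q\in\mathbb{C}[z]$ be a monic polynomial. Let $f\in\mathbb{C}[z]$ be a polynomial of degree $n$. (1) Assume that all zeros of $f$ lie in $q_\circ(D)$. Then all zeros of $T_{q,n}(f)$ lie in $q(D)$, and if $(u_1,\dots,u_n)\in\mathbb{C}^n$ is a zero of $S_{q,n}(f)=\mathrm{Sym}_n(T_{q,n}(f))$, then $u_k\in q(D)$ for some $k\in\{1,\dots,n\}$. (2) Assume that $f$ does not vanish in $q(D)$. Then $T_{q,n}(f)$ does not vanish in $q_\circ(D)$, and $S_{q,n}(f)$ does not vanish in $(q_\circ(D))^n$.
   Context: A circular domain is an open or closed disk or halfspace (half-plane) in $\mathbb{C}$, or the complement of any such set. For a polynomial $q$ and a set $D\subset\mathbb{C}$, $q(D)$ is the image of $D$ under $q\colon\mathbb{C}\to\mathbb{C}$, and $q_\circ(D)=\{u\in\mathbb{C} : q^{-1}(u)\subset D\}$. $\mathbb{C}[z]_m$ is the space of complex polynomials of degree at most $m$. For $f=\sum_{k=0}^m a_kz^k$, $g=\sum_{k=0}^m b_kz^k$ in $\mathbb{C}[z]_m$, the Fischer inner product is $\langle f,g\rangle_m=\sum_{k=0}^m\frac{1}{\binom{m}{k}}a_k\overline{b_k}$. For $f=\sum_{k=0}^m a_kz^k$ regarded as an element of $\mathbb{C}[z]_m$, put $f^\vee(z)=f(-z)$, $f^\#(z)=z^m\overline{f(1/\overline{z})}=\sum_{k=0}^m\overline{a_{m-k}}z^k$ (this depends on $m$), and $f^{\#\vee}=(f^\#)^\vee$.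 The symmetrization of $f=\sum_{k=0}^n a_kz^k\in\mathbb{C}[z]_n$ in degree $n$ is $\mathrm{Sym}_n(f)(y_1,\dots,y_n)=\sum_{k=0}^n\frac{a_k}{\binom{n}{k}}\sigma_k(y_1,\dots,y_n)$, with $\sigma_k$ the $k$-th elementary symmetric polynomial. For $q$ monic of degree $d$ and $f\in\mathbb{C}[z]_n$, define $$S_{q,n}(f)(u_1,\dots,u_n)=\Bigl\langle f\circ q,\ \prod_{j=1}^n(q-u_j)^{\#\vee}\Bigr\rangle_{nd},\qquad T_{q,n}(f)(z)=S_{q,n}(f)(z,\dots,z),$$ where each $q-u_j$ is regarded as an element of $\mathbb{C}[z]_d$ when forming $(q-u_j)^{\#\vee}$. *)

theory Defs
  imports "HOL-Analysis.Analysis" "HOL-Computational_Algebra.Polynomial"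
begin

definition disk_or_halfplane :: "complex set \<Rightarrow> bool" where
  "disk_or_halfplane B \<longleftrightarrow>
     (\<exists>c r. r > 0 \<and> (B = ball c r \<or> B = cball c r)) \<or>
     (\<exists>a b. a \<noteq> 0 \<and> (B = {z. a \<bullet> z < b} \<or> B = {z. a \<bullet> z \<le> b}))"

definition circular_domain :: "complex set \<Rightarrow> bool" where
  "circular_domain D \<longleftrightarrow> disk_or_halfplane D \<or> disk_or_halfplane (- D)"

definition fibre_inside :: "complex poly \<Rightarrow> complex set \<Rightarrow> complex set" where
  "fibre_inside q D = {u. poly q -` {u} \<subseteq> D}"

definition fischer :: "nat \<Rightarrow> complex poly \<Rightarrow> complex poly \<Rightarrow> complex" where
  "fischer m f g = (\<Sum>k\<le>m. 1 / of_nat (m choose k) * coeff f k * cnj (coeff g k))"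

definition vee :: "complex poly \<Rightarrow> complex poly" where
  "vee f = f \<circ>\<^sub>p [:0, -1:]"

(* The ambient degree m is a parameter: the polynomial is regarded as an element of the space of
   polynomials of degree at most m, so this is not reflect_poly, which uses the actual degree. *)
definition sharp :: "nat \<Rightarrow> complex poly \<Rightarrow> complex poly" where
  "sharp m f = (\<Sum>k\<le>m. monom (cnj (coeff f (m - k))) k)"

(* Points of complex n-space are functions on nat of which only the values at 1, ..., n matter. *)
definition elem_sym :: "nat \<Rightarrow> nat \<Rightarrow> (nat \<Rightarrow> complex) \<Rightarrow> complex" where
  "elem_sym n k y = (\<Sum>I | I \<subseteq> {1..n} \<and> card I = k. \<Prod>i\<in>I. y i)"

definition Sym :: "nat \<Rightarrow> complex poly \<Rightarrow> (nat \<Rightarrow> complex) \<Rightarrow> complex" where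
  "Sym n f y = (\<Sum>k\<le>n. coeff f k / of_nat (n choose k) * elem_sym n k y)"

definition S_op :: "complex poly \<Rightarrow> nat \<Rightarrow> complex poly \<Rightarrow> (nat \<Rightarrow> complex) \<Rightarrow> complex" where
  "S_op q n f u = fischer (n * degree q) (f \<circ>\<^sub>p q)
     (\<Prod>j=1..n. vee (sharp (degree q) (q - [:u j:])))"

(* The diagonal of S_op as a polynomial rather than a function; T_op_exists shows that there is
   one, of degree at most n, so that Sym n applies to it. *)
definition T_op :: "complex poly \<Rightarrow> nat \<Rightarrow> complex poly \<Rightarrow> complex poly" where
  "T_op q n f = (THE p. \<forall>z. poly p z = S_op q n f (\<lambda>_. z))"

lemma coeff_vee: "coeff (vee f) k = (-1) ^ k * coeff f k"
  by (simp add: vee_def coeff_pcompose_linear)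

lemma coeff_sharp: "coeff (sharp m f) k = (if k \<le> m then cnj (coeff f (m - k)) else 0)"
  by (simp add: sharp_def coeff_sum)

lemma cnj_coeff_factor:
  "\<exists>p. degree p \<le> 1 \<and> (\<forall>z. cnj (coeff (vee (sharp d (q - [:z:]))) k) = poly p z)"
proof -
  define p where "p = (if k \<le> d then
    (if k = d then [:(-1) ^ k * coeff q 0, - ((-1) ^ k):] else [:(-1) ^ k * coeff q (d - k):]) else 0)"
  have "degree p \<le> 1" by (simp add: p_def)
  moreover have "cnj (coeff (vee (sharp d (q - [:z:]))) k) = poly p z" for z
    by (auto simp: p_def coeff_vee coeff_sharp coeff_pCons algebra_simps split: nat.split)
  ultimately show ?thesis by blast
qed

lemma cnj_coeff_power:
  "\<exists>p. degree p \<le> n \<and> (\<forall>z. cnj (coeff (vee (sharp d (q - [:z:])) ^ n) k) = poly p z)"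
proof (induction n arbitrary: k)
  case 0
  show ?case by (rule exI[of _ "if k = 0 then 1 else 0"]) simp
next
  case (Suc n)
  obtain a where a: "\<And>i. degree (a i) \<le> 1"
      "\<And>i z. cnj (coeff (vee (sharp d (q - [:z:]))) i) = poly (a i) z"
    using cnj_coeff_factor[of d q] by metis
  obtain b where b: "\<And>i. degree (b i) \<le> n"
      "\<And>i z. cnj (coeff (vee (sharp d (q - [:z:])) ^ n) i) = poly (b i) z"
    using Suc.IH by metis
  have "degree (\<Sum>i\<le>k. a i * b (k - i)) \<le> Suc n"
  proof (rule degree_sum_le)
    show "degree (a i * b (k - i)) \<le> Suc n" for i
      using degree_mult_le[of "a i" "b (k - i)"] a(1)[of i] b(1)[of "k - i"] by linarith
  qed simp
  moreover have "cnj (coeff (vee (sharp d (q - [:z:])) ^ Suc n) k)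
      = poly (\<Sum>i\<le>k. a i * b (k - i)) z" for z
    by (simp add: coeff_mult poly_sum a(2) b(2))
  ultimately show ?case by blast
qed

lemma T_op_exists: "\<exists>p. degree p \<le> n \<and> (\<forall>z. poly p z = S_op q n f (\<lambda>_. z))"
proof -
  let ?m = "n * degree q"
  obtain b where b: "\<And>i. degree (b i) \<le> n"
      "\<And>i z. cnj (coeff (vee (sharp (degree q) (q - [:z:])) ^ n) i) = poly (b i) z"
    using cnj_coeff_power[of n "degree q" q] by metis
  define p where "p = (\<Sum>k\<le>?m. smult (1 / of_nat (?m choose k) * coeff (f \<circ>\<^sub>p q) k) (b k))"
  have "degree p \<le> n"
    unfolding p_def by (rule degree_sum_le) (auto intro: order_trans[OF degree_smult_le] b(1))
  moreover have "poly p z = S_op q n f (\<lambda>_. z)" for z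
    by (simp add: p_def S_op_def fischer_def poly_sum b(2))
  ultimately show ?thesis by blast
qed

lemma T_op_eqI:
  assumes "\<And>z. poly p z = S_op q n f (\<lambda>_. z)"
  shows "T_op q n f = p"
  unfolding T_op_def
  by (rule the_equality) (auto simp: assms poly_eq_poly_eq_iff[symmetric] fun_eq_iff)

lemma poly_T_op: "poly (T_op q n f) z = S_op q n f (\<lambda>_. z)"
  and degree_T_op: "degree (T_op q n f) \<le> n"
  using T_op_exists[of n q f] T_op_eqI[of _ q n f] by metis+

end

theory Submission
  imports Defs "HOL-Computational_Algebra.Fundamental_Theorem_Algebra"
begin

text \<open>
  Up to the involution in its second argument, the Fischer inner product is Grace's apolar form, so
  that \<open>S(u)\<close> is the apolar form of \<open>f \<circ> q\<close> and \<open>\<Prod>\<^sub>j (q - u\<^sub>j)\<close>. By Grace's theorem it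
  cannot vanish when a circular domain contains all zeros of one of the two polynomials and none of
  the other, which gives both parts. Grace's theorem follows from Laguerre's by splitting
  off the linear factors of the second polynomial one at a time: each turns into a polar derivative
  of the first. Since the apolar form is symmetric up to sign, it suffices to treat disks and
  half-planes, where convexity is available. Finally, expanding \<open>\<Prod>\<^sub>j (q - u\<^sub>j)\<close> in powers of \<open>q\<close>
  shows that \<open>S\<close> is a linear combination of elementary symmetric polynomials, hence the
  symmetrization of its diagonal.
\<close>

section \<open>The apolar form\<close>

text \<open>Writing the coefficients of F and G as binomial(m,k) A_k and binomial(m,k) B_k turns
  this into Grace's classical sum of (-1)^k binomial(m,k) A_k B_(m-k).\<close>

definition apolar_form :: "nat \<Rightarrow> complex poly \<Rightarrow> complex poly \<Rightarrow> complex" where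
  "apolar_form m F G =
     (\<Sum>k\<le>m. (-1) ^ k * coeff F k * coeff G (m - k) / of_nat (m choose k))"

text \<open>Laguerre's m F + (w - z) F' with pole w. For F of degree at most m the terms of degree m
  cancel, so the formal degree drops by one.\<close>

definition polar_deriv :: "nat \<Rightarrow> complex \<Rightarrow> complex poly \<Rightarrow> complex poly" where
  "polar_deriv m w F = smult (of_nat m) F + [:w, -1:] * pderiv F"

lemma apolar_form_commute: "apolar_form m F G = (-1) ^ m * apolar_form m G F"
proof -
  have "apolar_form m F G =
      (\<Sum>k\<le>m. (-1) ^ (m - k) * coeff F (m - k) * coeff G (m - (m - k)) / of_nat (m choose (m - k)))"
    unfolding apolar_form_def
    by (rule sum.reindex_bij_witness[of _ "\<lambda>k. m - k" "\<lambda>k. m - k"]) auto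
  also have "\<dots> = (\<Sum>k\<le>m. (-1) ^ m * ((-1) ^ k * coeff G k * coeff F (m - k) / of_nat (m choose k)))"
  proof (rule sum.cong)
    fix k assume "k \<in> {..m}"
    then have k: "k \<le> m" by simp
    \<comment> \<open>The exponents m + k and m - k differ by the even number 2k, so their signs
      agree.\<close>
    then have "m + k = (m - k) + 2 * k" by simp
    then have "(-1::complex) ^ (m - k) = (-1) ^ m * (-1) ^ k"
      by (auto dest!: arg_cong[of _ _ "\<lambda>i. (-1::complex) ^ i"] simp: power_add power_mult)
    with k show "(-1) ^ (m - k) * coeff F (m - k) * coeff G (m - (m - k)) / of_nat (m choose (m - k))
        = (-1) ^ m * ((-1) ^ k * coeff G k * coeff F (m - k) / of_nat (m choose k))"
      by (simp add: binomial_symmetric[symmetric])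
  qed simp
  also have "\<dots> = (-1) ^ m * apolar_form m G F"
    by (simp add: apolar_form_def sum_distrib_left)
  finally show ?thesis .
qed

lemma apolar_form_sum: "apolar_form m F (\<Sum>x\<in>A. G x) = (\<Sum>x\<in>A. apolar_form m F (G x))"
  unfolding apolar_form_def
  by (simp add: coeff_sum sum_distrib_left sum_divide_distrib) (rule sum.swap)

lemma apolar_form_smult: "apolar_form m F (smult c G) = c * apolar_form m F G"
  by (simp add: apolar_form_def sum_distrib_left mult_ac)

lemma apolar_form_0_right [simp]: "apolar_form m F 0 = 0"
  by (simp add: apolar_form_def)

lemma coeff_polar_deriv:
  "coeff (polar_deriv m w F) k =
     (of_nat m - of_nat k) * coeff F k + w * of_nat (Suc k) * coeff F (Suc k)"
  by (cases k) (simp_all add: polar_deriv_def coeff_pderiv algebra_simps)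

text \<open>The absorption identities for (m+1 choose k) and (m+1 choose k+1) convert the weights of
  degree m+1 into those of degree m; the factors they leave behind are those in
  \<open>coeff_polar_deriv\<close>.\<close>

lemma apolar_form_linear_factor:
  assumes "degree H \<le> m"
  shows "of_nat (Suc m) * apolar_form (Suc m) F ([:- w, 1:] * H)
       = apolar_form m (polar_deriv (Suc m) w F) H"
proof -
  let ?b = "\<lambda>k. of_nat (Suc m choose k) :: complex"
  let ?g = "\<lambda>k. (-1) ^ k * coeff F k * coeff H (m - k) / ?b k"
  let ?h = "\<lambda>k. (-1) ^ k * coeff F k * (w * coeff H (Suc m - k)) / ?b k"
  \<comment> \<open>The case split is needed at k = m+1, where truncated subtraction would wrongly
    produce \<open>coeff H 0\<close>.\<close>
  have cf: "coeff ([:- w, 1:] * H) (Suc m - k)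
      = (if k \<le> m then coeff H (m - k) else 0) - w * coeff H (Suc m - k)" if "k \<le> Suc m" for k
    using that by (cases "k \<le> m") (auto simp: Suc_diff_le not_le le_Suc_eq)
  have "apolar_form (Suc m) F ([:- w, 1:] * H)
      = (\<Sum>k\<le>Suc m. (if k \<le> m then ?g k else 0) - ?h k)"
    unfolding apolar_form_def
    by (rule sum.cong) (simp_all only: cf atMost_iff, auto simp: algebra_simps diff_divide_distrib)
  also have "\<dots> = (\<Sum>k\<le>m. ?g k) - (\<Sum>k\<le>Suc m. ?h k)"
    by (simp add: sum_subtractf)
  \<comment> \<open>The dropped term k = 0 contains the coefficient of H at m+1, which is zero by
    the degree bound.\<close>
  also have "(\<Sum>k\<le>Suc m. ?h k) = (\<Sum>k\<le>m. ?h (Suc k))"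
    using assms by (subst sum.atMost_Suc_shift) (simp add: coeff_eq_0)
  finally have "apolar_form (Suc m) F ([:- w, 1:] * H) = (\<Sum>k\<le>m. ?g k - ?h (Suc k))"
    by (simp only: sum_subtractf)
  then have "of_nat (Suc m) * apolar_form (Suc m) F ([:- w, 1:] * H)
      = (\<Sum>k\<le>m. of_nat (Suc m) * (?g k - ?h (Suc k)))"
    by (simp only: sum_distrib_left)
  also have "\<dots> = apolar_form m (polar_deriv (Suc m) w F) H"
    unfolding apolar_form_def
  proof (rule sum.cong)
    fix k assume "k \<in> {..m}"
    then have k: "k \<le> m" by simp
    let ?c = "of_nat (m choose k) :: complex"
    have nz: "?b k \<noteq> 0" "?b (Suc k) \<noteq> 0" "?c \<noteq> 0" using k by (simp_all del: binomial_Suc_Suc)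
    have "(Suc m - k) * (Suc m choose k) = Suc m * (m choose k)"
      using binomial_absorb_comp[of "Suc m" k] by simp
    then have "of_nat (Suc m - k) * ?b k = of_nat (Suc m) * ?c"
      by (metis of_nat_mult)
    then have e1: "of_nat (Suc m) / ?b k = (of_nat (Suc m) - of_nat k) / ?c"
      using k nz by (simp add: of_nat_diff field_simps)
    have "Suc k * (Suc m choose Suc k) = Suc m * (m choose k)"
      by (rule Suc_times_binomial)
    then have "of_nat (Suc k) * ?b (Suc k) = of_nat (Suc m) * ?c"
      by (metis of_nat_mult)
    then have e2: "of_nat (Suc m) / ?b (Suc k) = of_nat (Suc k) / ?c"
      using nz by (simp add: field_simps del: of_nat_Suc binomial_Suc_Suc)
    have "of_nat (Suc m) * (?g k - ?h (Suc k)) =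
        (-1) ^ k * coeff H (m - k) * (coeff F k * (of_nat (Suc m) / ?b k)
          + w * coeff F (Suc k) * (of_nat (Suc m) / ?b (Suc k)))"
      by (simp add: algebra_simps del: of_nat_Suc binomial_Suc_Suc)
    also have "\<dots> = (-1) ^ k * coeff H (m - k) * (coeff (polar_deriv (Suc m) w F) k / ?c)"
      unfolding e1 e2 coeff_polar_deriv
      by (simp add: add_divide_distrib mult_ac del: of_nat_Suc)
    finally show "of_nat (Suc m) * (?g k - ?h (Suc k)) =
        (-1) ^ k * coeff (polar_deriv (Suc m) w F) k * coeff H (m - k) / ?c"
      by (simp add: mult_ac)
  qed simp
  finally show ?thesis .
qed

section \<open>Laguerre's theorem\<close>

lemma convex_on_quadratic:
  fixes c :: complex
  assumes "K \<ge> 0"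
  shows "convex_on UNIV (\<lambda>s. K * (norm s)\<^sup>2 + c \<bullet> s + e)"
proof (rule convex_onI)
  fix t :: real and x y :: complex
  assume t: "0 < t" "t < 1"
  have *: "(norm z)\<^sup>2 = (Re z)\<^sup>2 + (Im z)\<^sup>2" for z :: complex
    by (simp add: cmod_power2)
  \<comment> \<open>The affine part cancels in the convexity defect, leaving K times the defect of
    the squared norm.\<close>
  have "(1 - t) * (K * (norm x)\<^sup>2 + c \<bullet> x + e) + t * (K * (norm y)\<^sup>2 + c \<bullet> y + e)
      - (K * (norm ((1 - t) *\<^sub>R x + t *\<^sub>R y))\<^sup>2 + c \<bullet> ((1 - t) *\<^sub>R x + t *\<^sub>R y) + e)
      = K * (t * (1 - t) * (norm (x - y))\<^sup>2)"
    unfolding * inner_complex_def by (simp add: algebra_simps power2_eq_square)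
  also have "\<dots> \<ge> 0" using assms t by simp
  finally show "K * (norm ((1 - t) *\<^sub>R x + t *\<^sub>R y))\<^sup>2 + c \<bullet> ((1 - t) *\<^sub>R x + t *\<^sub>R y) + e
      \<le> (1 - t) * (K * (norm x)\<^sup>2 + c \<bullet> x + e) + t * (K * (norm y)\<^sup>2 + c \<bullet> y + e)"
    by simp
qed simp

lemma convex_quadratic_sublevel:
  fixes c :: complex
  assumes "K \<ge> 0"
  shows "convex {s. K * (norm s)\<^sup>2 + c \<bullet> s + e < 0}" "convex {s. K * (norm s)\<^sup>2 + c \<bullet> s + e \<le> 0}"
proof -
  note cv = convex_onD[OF convex_on_quadratic[OF assms]]
  let ?Q = "\<lambda>s. K * (norm s)\<^sup>2 + c \<bullet> s + e"
  have *: "?Q (u *\<^sub>R x + v *\<^sub>R y) \<le> u * ?Q x + v * ?Q y"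
    if "u \<ge> 0" "v \<ge> 0" "u + v = 1" for u v x y
  proof -
    have "u = 1 - v" using that by simp
    then show ?thesis using cv[of v x y c e] that by (simp only: UNIV_I simp_thms)
  qed
  show "convex {s. ?Q s < 0}"
  proof (rule convexI)
    fix x y and u v :: real
    assume a: "x \<in> {s. ?Q s < 0}" "y \<in> {s. ?Q s < 0}" "0 \<le> u" "0 \<le> v" "u + v = 1"
    have "u * ?Q x + v * ?Q y < 0"
      by (rule convex_bound_lt) (use a in auto)
    with *[of u v x y] a show "u *\<^sub>R x + v *\<^sub>R y \<in> {s. ?Q s < 0}" by auto
  qed
  show "convex {s. ?Q s \<le> 0}"
  proof (rule convexI)
    fix x y and u v :: real
    assume a: "x \<in> {s. ?Q s \<le> 0}" "y \<in> {s. ?Q s \<le> 0}" "0 \<le> u" "0 \<le> v" "u + v = 1"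
    have "u * ?Q x + v * ?Q y \<le> 0"
      by (rule convex_bound_le) (use a in auto)
    with *[of u v x y] a show "u *\<^sub>R x + v *\<^sub>R y \<in> {s. ?Q s \<le> 0}" by auto
  qed
qed

lemma disk_or_halfplane_cases:
  assumes "disk_or_halfplane B"
  obtains (disk) c r where "r > 0" "B = ball c r \<or> B = cball c r"
    | (halfplane) a b where "a \<noteq> 0" "B = {z. a \<bullet> z < b} \<or> B = {z. a \<bullet> z \<le> b}"
  using assms unfolding disk_or_halfplane_def
proof (elim disjE[where P = "\<exists>c r. _ c r"] exE)
  fix c r assume "r > 0 \<and> (B = ball c r \<or> B = cball c r)"
  then show thesis using disk by metis
next
  fix a b assume "a \<noteq> 0 \<and> (B = {z. a \<bullet> z < b} \<or> B = {z. a \<bullet> z \<le> b})"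
  then show thesis using halfplane by metis
qed

text \<open>Disks (A = 1) and half-planes (A = 0) share one normal form, stable under inversion up
  to the sign of the leading coefficient.\<close>

lemma disk_or_halfplane_quadratic:
  assumes "disk_or_halfplane D"
  obtains A b e where "A \<ge> 0"
    "D = {x. A * (norm x)\<^sup>2 + b \<bullet> x + e < 0} \<or> D = {x. A * (norm x)\<^sup>2 + b \<bullet> x + e \<le> 0}"
proof -
  show ?thesis
    using assms
  proof (cases rule: disk_or_halfplane_cases)
    case (disk c r)
    have *: "1 * (norm x)\<^sup>2 + ((-2) *\<^sub>R c) \<bullet> x + ((norm c)\<^sup>2 - r\<^sup>2) = (dist c x)\<^sup>2 - r\<^sup>2" for x
      unfolding dist_norm cmod_power2 inner_complex_def by (simp add: algebra_simps power2_eq_square)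
    have "dist c x < r \<longleftrightarrow> (dist c x)\<^sup>2 < r\<^sup>2" "dist c x \<le> r \<longleftrightarrow> (dist c x)\<^sup>2 \<le> r\<^sup>2" for x
      using disk(1) power_mono_iff[of "dist c x" r 2] power_mono_iff[of r "dist c x" 2]
      by (simp_all add: linorder_not_le[symmetric] del: linorder_not_le)
    then have "x \<in> ball c r \<longleftrightarrow> (dist c x)\<^sup>2 - r\<^sup>2 < 0" "x \<in> cball c r \<longleftrightarrow> (dist c x)\<^sup>2 - r\<^sup>2 \<le> 0" for x
      by (metis mem_ball diff_less_0_iff_less, metis mem_cball diff_le_0_iff_le)
    then have "ball c r = {x. 1 * (norm x)\<^sup>2 + ((-2) *\<^sub>R c) \<bullet> x + ((norm c)\<^sup>2 - r\<^sup>2) < 0}"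
      "cball c r = {x. 1 * (norm x)\<^sup>2 + ((-2) *\<^sub>R c) \<bullet> x + ((norm c)\<^sup>2 - r\<^sup>2) \<le> 0}"
      by (simp_all only: * set_eq_iff mem_Collect_eq simp_thms)
    with disk(2) show ?thesis
      by (intro that[of 1 "(-2) *\<^sub>R c" "(norm c)\<^sup>2 - r\<^sup>2"] zero_le_one) (simp only:)
  next
    case (halfplane a \<beta>)
    then show ?thesis by (intro that[of 0 a "- \<beta>"]) auto
  qed
qed

lemma disk_or_halfplane_convex: "disk_or_halfplane D \<Longrightarrow> convex D"
  by (erule disk_or_halfplane_quadratic) (auto intro: convex_quadratic_sublevel)

text \<open>
  Inversion in a point outside \<open>D\<close> maps \<open>D\<close> into a convex set. Only points \<open>\<alpha> \<noteq> z\<close> are compared,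
  since the convex set may contain 0, the image of infinity.
\<close>
lemma disk_or_halfplane_inverse_convex:
  assumes "disk_or_halfplane D" "z \<notin> D"
  obtains S where "convex S" "\<And>\<alpha>. \<alpha> \<noteq> z \<Longrightarrow> 1 / (z - \<alpha>) \<in> S \<longleftrightarrow> \<alpha> \<in> D"
proof -
  obtain A b e where A: "A \<ge> 0"
    and D: "D = {x. A * (norm x)\<^sup>2 + b \<bullet> x + e < 0} \<or> D = {x. A * (norm x)\<^sup>2 + b \<bullet> x + e \<le> 0}"
    by (rule disk_or_halfplane_quadratic[OF assms(1)])
  \<comment> \<open>With t = z - \<alpha> and s = 1/t, expanding the quadratic at z - t and dividing
    by |t|^2 gives K |s|^2 + c . s + A. The conjugate in \<open>c\<close> comes from t / |t|^2 = cnj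
    s.\<close>
  define K where "K = A * (norm z)\<^sup>2 + b \<bullet> z + e"
  define c where "c = - cnj ((2 * A) *\<^sub>R z + b)"
  \<comment> \<open>This is where z outside D enters: K is the value of the quadratic at z, and its
    sign makes the transformed sublevel set convex.\<close>
  have K: "K \<ge> 0" using D assms(2) unfolding K_def by auto
  let ?Q = "\<lambda>x. A * (norm x)\<^sup>2 + b \<bullet> x + e"
  let ?R = "\<lambda>s. K * (norm s)\<^sup>2 + c \<bullet> s + A"
  have eq: "?R (1 / (z - \<alpha>)) = ?Q \<alpha> / (norm (z - \<alpha>))\<^sup>2" if "\<alpha> \<noteq> z" for \<alpha>
  proof -
    define t where "t = z - \<alpha>"
    have t: "t \<noteq> 0" "\<alpha> = z - t" using that by (auto simp: t_def)
    then have n: "(norm t)\<^sup>2 \<noteq> 0" by simp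
    have c: "c \<bullet> (1 / t) = (- ((2 * A) *\<^sub>R z + b) \<bullet> t) / (norm t)\<^sup>2"
      using n unfolding c_def inner_complex_def cmod_power2
      by (simp add: Re_divide Im_divide power2_eq_square divide_simps) (simp add: algebra_simps)
    have "?R (1 / t) * (norm t)\<^sup>2 = K + (- ((2 * A) *\<^sub>R z + b) \<bullet> t) + A * (norm t)\<^sup>2"
      using n by (simp add: c norm_divide power_divide distrib_right)
    also have "\<dots> = ?Q (z - t)"
      unfolding K_def inner_complex_def cmod_power2 by (simp add: algebra_simps power2_eq_square)
    finally show ?thesis using n t unfolding t_def by (simp add: field_simps)
  qed
  have sgn: "?R (1 / (z - \<alpha>)) < 0 \<longleftrightarrow> ?Q \<alpha> < 0" "?R (1 / (z - \<alpha>)) \<le> 0 \<longleftrightarrow> ?Q \<alpha> \<le> 0"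
    if "\<alpha> \<noteq> z" for \<alpha>
    unfolding eq[OF that] using that by (simp_all add: divide_less_0_iff divide_le_0_iff)
  from D show ?thesis
  proof
    assume "D = {x. ?Q x < 0}"
    then show ?thesis
      by (intro that[OF convex_quadratic_sublevel(1)[OF K, of c A]]) (simp only: mem_Collect_eq sgn simp_thms)
  next
    assume "D = {x. ?Q x \<le> 0}"
    then show ?thesis
      by (intro that[OF convex_quadratic_sublevel(2)[OF K, of c A]]) (simp only: mem_Collect_eq sgn simp_thms)
  qed
qed

section \<open>Means over the roots of a polynomial\<close>

lemma poly_root_Suc_degree:
  fixes F :: "complex poly"
  assumes "degree F = Suc m"
  obtains \<alpha> H where "F = [:- \<alpha>, 1:] * H" "degree H = m" "poly F \<alpha> = 0"
proof -
  obtain \<alpha> where \<alpha>: "poly F \<alpha> = 0"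
    using assms fundamental_theorem_of_algebra constant_degree[of F] by auto
  then obtain H where H: "F = [:- \<alpha>, 1:] * H" by (metis poly_eq_0_iff_dvd dvdE)
  have "H \<noteq> 0" using H assms by auto
  then have "degree F = Suc (degree H)" unfolding H by (subst degree_mult_eq) auto
  with assms H \<alpha> that show ?thesis by auto
qed

text \<open>Updates a running mean: if y is the mean of m numbers, the result is their mean together
  with x.\<close>

lemma convex_mean_step:
  fixes S :: "complex set"
  assumes "convex S" "x \<in> S" "y \<in> S"
  shows "(x + of_nat m * y) / of_nat (Suc m) \<in> S"
proof -
  have "(1 / real (Suc m)) *\<^sub>R x + (real m / real (Suc m)) *\<^sub>R y \<in> S"
    by (rule convexD[OF assms]) (simp_all add: field_simps)
  also have "(1 / real (Suc m)) *\<^sub>R x + (real m / real (Suc m)) *\<^sub>R y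
      = (x + of_nat m * y) / of_nat (Suc m)"
    by (simp add: scaleR_conv_of_real add_divide_distrib del: of_nat_Suc)
  finally show ?thesis .
qed

text \<open>By Vieta the quotient is the arithmetic mean of the roots, counted with
  multiplicity.\<close>

lemma centroid_in_convex:
  fixes F :: "complex poly"
  assumes "convex S" "degree F = Suc m" "\<And>\<alpha>. poly F \<alpha> = 0 \<Longrightarrow> \<alpha> \<in> S"
  shows "- coeff F m / (of_nat (Suc m) * coeff F (Suc m)) \<in> S"
  using assms(2,3)
proof (induction m arbitrary: F)
  case 0
  obtain \<alpha> H where F: "F = [:- \<alpha>, 1:] * H" "degree H = 0" "poly F \<alpha> = 0"
    using poly_root_Suc_degree[OF 0(1)] .
  then obtain h where h: "H = [:h:]" by (metis degree_eq_zeroE)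
  have "h \<noteq> 0" using F h 0 by auto
  then show ?case using F h 0(2)[of \<alpha>] by simp
next
  case (Suc m)
  obtain \<alpha> H where F: "F = [:- \<alpha>, 1:] * H" "degree H = Suc m" "poly F \<alpha> = 0"
    using poly_root_Suc_degree[OF Suc.prems(1)] .
  have "- coeff H m / (of_nat (Suc m) * coeff H (Suc m)) \<in> S" (is "?y \<in> S")
    by (rule Suc.IH[OF F(2)]) (use Suc.prems(2) F(1) in auto)
  from convex_mean_step[OF assms(1) Suc.prems(2)[OF F(3)] this, of "Suc m"]
  have "(\<alpha> + of_nat (Suc m) * ?y) / of_nat (Suc (Suc m)) \<in> S" .
  moreover have nz: "coeff H (Suc m) \<noteq> 0" using F(2) by (metis leading_coeff_0_iff degree_0 nat.distinct(1))
  have "coeff H (Suc (Suc m)) = 0" using F(2) by (simp add: coeff_eq_0)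
  then have "coeff F (Suc m) = coeff H m - \<alpha> * coeff H (Suc m)" "coeff F (Suc (Suc m)) = coeff H (Suc m)"
    using F(1) by simp_all
  then have "- coeff F (Suc m) / (of_nat (Suc (Suc m)) * coeff F (Suc (Suc m)))
      = (\<alpha> + of_nat (Suc m) * ?y) / of_nat (Suc (Suc m))"
    using nz by (simp add: field_simps del: of_nat_Suc)
  ultimately show ?case by metis
qed

text \<open>Since F'/F is the sum of 1/(z - \<alpha>) over the roots with multiplicity, the quotient
  is the mean of these numbers.\<close>

lemma log_derivative_in_convex:
  fixes F :: "complex poly"
  assumes "convex S" "degree F = Suc m" "poly F z \<noteq> 0"
    and "\<And>\<alpha>. poly F \<alpha> = 0 \<Longrightarrow> 1 / (z - \<alpha>) \<in> S"
  shows "poly (pderiv F) z / (of_nat (Suc m) * poly F z) \<in> S"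
  using assms(2-)
proof (induction m arbitrary: F)
  case 0
  obtain \<alpha> H where F: "F = [:- \<alpha>, 1:] * H" "degree H = 0" "poly F \<alpha> = 0"
    using poly_root_Suc_degree[OF 0(1)] .
  then obtain h where h: "H = [:h:]" by (metis degree_eq_zeroE)
  have "poly (pderiv F) z / poly F z = 1 / (z - \<alpha>)"
    using F h 0 by (simp add: pderiv_pCons field_simps)
  then show ?case using 0(3)[OF F(3)] by simp
next
  case (Suc m)
  obtain \<alpha> H where F: "F = [:- \<alpha>, 1:] * H" "degree H = Suc m" "poly F \<alpha> = 0"
    using poly_root_Suc_degree[OF Suc.prems(1)] .
  have nz: "poly H z \<noteq> 0" "z - \<alpha> \<noteq> 0" using Suc.prems(2) F by auto
  have "poly (pderiv H) z / (of_nat (Suc m) * poly H z) \<in> S" (is "?y \<in> S")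
    by (rule Suc.IH[OF F(2) nz(1)]) (use Suc.prems(3) F(1) in auto)
  from convex_mean_step[OF assms(1) Suc.prems(3)[OF F(3)] this, of "Suc m"]
  have "(1 / (z - \<alpha>) + of_nat (Suc m) * ?y) / of_nat (Suc (Suc m)) \<in> S" .
  moreover have "poly F z = (z - \<alpha>) * poly H z"
      "poly (pderiv F) z = poly H z + (z - \<alpha>) * poly (pderiv H) z"
    unfolding F(1) by (simp_all only: pderiv_mult, simp_all add: pderiv_pCons algebra_simps)
  then have "poly (pderiv F) z / (of_nat (Suc (Suc m)) * poly F z)
      = (1 / (z - \<alpha>) + of_nat (Suc m) * ?y) / of_nat (Suc (Suc m))"
    using nz by (simp add: divide_simps del: of_nat_Suc)
  ultimately show ?case by metis
qed

text \<open>Both claims place a mean in a convex set: the centroid of the roots in D for the degree,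
  the mean of the inverted roots in an inverted copy of D for the zeros. The exact degree is what
  keeps the induction for Grace's theorem going.\<close>

lemma laguerre:
  assumes D: "disk_or_halfplane D" and deg: "degree F = Suc m"
    and roots: "\<And>\<alpha>. poly F \<alpha> = 0 \<Longrightarrow> \<alpha> \<in> D" and w: "w \<notin> D"
  shows "degree (polar_deriv (Suc m) w F) = m"
    and "poly (polar_deriv (Suc m) w F) z = 0 \<Longrightarrow> z \<in> D"
proof -
  let ?P = "polar_deriv (Suc m) w F"
  have lc: "coeff F (Suc m) \<noteq> 0" using deg by (metis leading_coeff_0_iff degree_0 nat.distinct(1))
  \<comment> \<open>This coefficient vanishes only if w is the centroid of the roots, a point of
    D.\<close>
  have "coeff ?P m \<noteq> 0"
  proof
    assume "coeff ?P m = 0"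
    then have "w * (of_nat (Suc m) * coeff F (Suc m)) = - coeff F m"
      by (simp add: coeff_polar_deriv eq_neg_iff_add_eq_0 algebra_simps)
    then have "w = - coeff F m / (of_nat (Suc m) * coeff F (Suc m))"
      using lc by (subst eq_divide_eq) (simp del: of_nat_Suc)
    then show False
      using centroid_in_convex[OF disk_or_halfplane_convex[OF D] deg roots] w by metis
  qed
  moreover have "coeff ?P k = 0" if "k > m" for k
    using that deg by (cases "k = Suc m") (auto simp: coeff_polar_deriv coeff_eq_0)
  ultimately show "degree ?P = m"
    by (meson degree_le le_antisym le_degree)
  show "z \<in> D" if "poly ?P z = 0"
  proof (rule ccontr)
    assume z: "z \<notin> D"
    then have Fz: "poly F z \<noteq> 0" using roots by blast
    obtain S where S: "convex S" "\<And>\<alpha>. \<alpha> \<noteq> z \<Longrightarrow> 1 / (z - \<alpha>) \<in> S \<longleftrightarrow> \<alpha> \<in> D"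
      using disk_or_halfplane_inverse_convex[OF D z] by blast
    \<comment> \<open>so \<open>1 / (z - w)\<close> is the mean of the numbers \<open>1 / (z - \<alpha>)\<close> over the roots \<open>\<alpha>\<close>\<close>
    have eq: "of_nat (Suc m) * poly F z = (z - w) * poly (pderiv F) z"
      using that by (simp add: polar_deriv_def algebra_simps del: of_nat_Suc)
    have "of_nat (Suc m) * poly F z \<noteq> 0" using Fz by (simp del: of_nat_Suc)
    then have nz: "z - w \<noteq> 0" "poly (pderiv F) z \<noteq> 0" using eq by auto
    have "poly (pderiv F) z / (of_nat (Suc m) * poly F z) \<in> S"
      by (rule log_derivative_in_convex[OF S(1) deg Fz]) (metis S(2) roots z)
    then have "1 / (z - w) \<in> S" unfolding eq using nz by simp
    then show False using S(2)[of w] nz w by auto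
  qed
qed

section \<open>Grace's theorem\<close>

lemma grace_disk_or_halfplane:
  assumes "disk_or_halfplane D" "degree F = m" "degree G = m" "F \<noteq> 0" "G \<noteq> 0"
    and "\<And>z. poly F z = 0 \<Longrightarrow> z \<in> D" "\<And>z. poly G z = 0 \<Longrightarrow> z \<notin> D"
  shows "apolar_form m F G \<noteq> 0"
  using assms(2-)
proof (induction m arbitrary: F G)
  case 0
  then show ?case
    by (auto simp: apolar_form_def elim!: degree_eq_zeroE)
next
  case (Suc m)
  obtain w H where G: "G = [:- w, 1:] * H" "degree H = m" "poly G w = 0"
    using poly_root_Suc_degree[OF Suc.prems(2)] .
  have w: "w \<notin> D" using Suc.prems(6) G(3) by blast
  let ?P = "polar_deriv (Suc m) w F"
  note L = laguerre[OF assms(1) Suc.prems(1) Suc.prems(5) w]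
  \<comment> \<open>For m = 0 the degree alone does not exclude the zero polynomial, but that would
    have w as a zero.\<close>
  have "?P \<noteq> 0"
  proof
    assume "?P = 0"
    then have "w \<in> D" using L(2)[of w] by simp
    with w show False by simp
  qed
  moreover have "H \<noteq> 0" using G(1) Suc.prems(4) by auto
  ultimately have "apolar_form m ?P H \<noteq> 0"
    using Suc.IH[OF L(1) G(2)] L(2) Suc.prems(6) G(1) by auto
  then show ?case
    using apolar_form_linear_factor[of H m F w] G by auto
qed

text \<open>Allows root conditions to exclude the zero polynomial, which vanishes both inside and
  outside D.\<close>

lemma circular_domain_proper:
  assumes "circular_domain D"
  shows "D \<noteq> {}" "D \<noteq> UNIV"
proof -
  have *: "B \<noteq> {} \<and> B \<noteq> UNIV" if "disk_or_halfplane B" for B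
    using that
  proof (cases rule: disk_or_halfplane_cases)
    case (disk c r)
    then have "c \<in> B" "bounded B" by auto
    then show ?thesis by auto
  next
    case (halfplane a b)
    define x y where "x = ((b - 1) / (a \<bullet> a)) *\<^sub>R a" and "y = ((b + 1) / (a \<bullet> a)) *\<^sub>R a"
    have "a \<bullet> x = b - 1" "a \<bullet> y = b + 1" using halfplane(1) by (simp_all add: x_def y_def)
    then have "x \<in> B" "y \<notin> B" using halfplane(2) by auto
    then show ?thesis by auto
  qed
  show "D \<noteq> {}" "D \<noteq> UNIV"
    using assms * unfolding circular_domain_def by auto
qed

theorem grace:
  assumes D: "circular_domain D" and deg: "degree F = m" "degree G = m"
    and roots: "\<And>z. poly F z = 0 \<Longrightarrow> z \<in> D" "\<And>z. poly G z = 0 \<Longrightarrow> z \<notin> D"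
  shows "apolar_form m F G \<noteq> 0"
proof -
  have nz: "F \<noteq> 0" "G \<noteq> 0" using roots circular_domain_proper[OF D] by auto
  from D show ?thesis unfolding circular_domain_def
  proof
    assume "disk_or_halfplane D"
    then show ?thesis using grace_disk_or_halfplane deg nz roots by blast
  next
    assume "disk_or_halfplane (- D)"
    \<comment> \<open>Here G takes the role of the polynomial with all zeros in the disk or
      half-plane.\<close>
    then have "apolar_form m G F \<noteq> 0"
      using grace_disk_or_halfplane[of "- D" G m F] deg nz roots by blast
    then show ?thesis by (simp add: apolar_form_commute[of m F G])
  qed
qed

section \<open>The operators S and T\<close>

text \<open>When the ambient degree is the actual one, \<open>sharp\<close> is a conjugated
  reflection and hence multiplicative.\<close>

lemma sharp_degree: "sharp (degree p) p = map_poly cnj (reflect_poly p)"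
  by (rule poly_eqI) (simp add: coeff_sharp coeff_map_poly coeff_reflect_poly)

lemma prod_vee_sharp:
  assumes "\<And>j. j \<in> A \<Longrightarrow> degree (p j) = d"
  shows "(\<Prod>j\<in>A. vee (sharp d (p j))) = vee (map_poly cnj (reflect_poly (\<Prod>j\<in>A. p j)))"
proof -
  have "(\<Prod>j\<in>A. vee (sharp d (p j))) = (\<Prod>j\<in>A. vee (map_poly cnj (reflect_poly (p j))))"
    using assms by (intro prod.cong) (auto simp flip: sharp_degree)
  also have "\<dots> = vee (map_poly cnj (reflect_poly (\<Prod>j\<in>A. p j)))"
    by (simp add: poly_eq_poly_eq_iff[symmetric] fun_eq_iff poly_prod vee_def poly_pcompose
        reflect_poly_prod)
  finally show ?thesis .
qed

text \<open>The conjugation in the inner product undoes the one in \<open>sharp\<close>, and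
  \<open>vee\<close> supplies the alternating sign.\<close>

lemma fischer_vee_sharp:
  assumes "degree G = m"
  shows "fischer m F (vee (map_poly cnj (reflect_poly G))) = apolar_form m F G"
  unfolding fischer_def apolar_form_def assms[symmetric] sharp_degree[symmetric]
  by (rule sum.cong) (auto simp: coeff_vee coeff_sharp)

lemma degree_minus_const: "degree (q - [:u:]) = degree q" for q :: "complex poly"
proof (cases "degree q = 0")
  case True
  then show ?thesis by (auto elim: degree_eq_zeroE)
next
  case False
  then have "degree (q + [:- u:]) = degree q" by (intro degree_add_eq_left) simp
  also have "q + [:- u:] = q - [:u:]" by simp
  finally show ?thesis .
qed

lemma S_op_eq_apolar_form:
  "S_op q n f u = apolar_form (n * degree q) (f \<circ>\<^sub>p q) (\<Prod>j=1..n. q - [:u j:])"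
proof -
  let ?G = "\<Prod>j=1..n. q - [:u j:]"
  have S: "S_op q n f u = fischer (n * degree q) (f \<circ>\<^sub>p q) (vee (map_poly cnj (reflect_poly ?G)))"
    unfolding S_op_def by (subst prod_vee_sharp) (simp_all add: degree_minus_const)
  show ?thesis
  \<comment> \<open>The product is zero only if q is a constant equal to some u_j; otherwise degrees
    add over the factors.\<close>
  proof (cases "?G = 0")
    case True
    then show ?thesis by (simp only: S) (simp add: fischer_def vee_def)
  next
    case False
    then have "degree ?G = n * degree q"
      by (subst degree_prod_eq_sum_degree) (auto simp: degree_minus_const)
    then show ?thesis by (simp only: S fischer_vee_sharp)
  qed
qed

text \<open>Vieta's expansion with q as the variable: expand over subsets, then group them by
  cardinality.\<close>

lemma prod_minus_const_elem_sym:
  fixes q :: "complex poly"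
  shows "(\<Prod>j=1..n. q - [:u j:]) = (\<Sum>k\<le>n. smult ((-1) ^ k * elem_sym n k u) (q ^ (n - k)))"
proof -
  let ?g = "\<lambda>I. smult ((-1) ^ card I * (\<Prod>i\<in>I. u i)) (q ^ (n - card I))"
  have const: "(\<Prod>i\<in>I. [:- u i:]) = [:(-1) ^ card I * (\<Prod>i\<in>I. u i):]" if "finite I" for I
    using that by (induction I) simp_all
  have "(\<Prod>j=1..n. q - [:u j:]) = (\<Prod>j=1..n. [:- u j:] + q)"
    by (rule prod.cong) simp_all
  also have "\<dots> = (\<Sum>I\<in>Pow {1..n}. (\<Prod>i\<in>I. [:- u i:]) * (\<Prod>i\<in>{1..n} - I. q))"
    by (rule prod_add) simp
  also have "\<dots> = (\<Sum>I\<in>Pow {1..n}. ?g I)"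
    by (rule sum.cong) (auto simp: const card_Diff_subset finite_subset[of _ "{1..n}"])
  also have "\<dots> = (\<Sum>k\<le>n. \<Sum>I | I \<in> Pow {1..n} \<and> card I = k. ?g I)"
    by (rule sum.group[symmetric]) (auto dest: card_mono[of "{1..n}", simplified])
  also have "\<dots> = (\<Sum>k\<le>n. smult ((-1) ^ k * elem_sym n k u) (q ^ (n - k)))"
    by (rule sum.cong) (simp_all add: elem_sym_def sum_distrib_left smult_sum)
  finally show ?thesis .
qed

lemma elem_sym_const: "elem_sym n k (\<lambda>_. z) = of_nat (n choose k) * z ^ k"
  using n_subsets[of "{1..n}" k] by (simp add: elem_sym_def)

text \<open>The coefficients \<open>c k\<close> do not depend on u. On the diagonal each elementary
  symmetric polynomial contributes a binomial coefficient, which \<open>Sym\<close> divides out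
  again.\<close>

lemma S_op_eq_Sym: "S_op q n f u = Sym n (T_op q n f) u"
proof -
  define c where "c k = (-1) ^ k * apolar_form (n * degree q) (f \<circ>\<^sub>p q) (q ^ (n - k))" for k
  have S: "S_op q n f v = (\<Sum>k\<le>n. c k * elem_sym n k v)" for v
    unfolding S_op_eq_apolar_form prod_minus_const_elem_sym
    by (simp add: apolar_form_sum apolar_form_smult c_def mult_ac)
  have T: "T_op q n f = (\<Sum>k\<le>n. monom (c k * of_nat (n choose k)) k)"
    by (rule T_op_eqI) (simp add: S elem_sym_const poly_sum poly_monom mult_ac)
  have "coeff (T_op q n f) k = c k * of_nat (n choose k)" if "k \<le> n" for k
    using that by (simp add: T coeff_sum)
  then show ?thesis by (simp add: S Sym_def)
qed

theorem theorem3p6: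
  fixes D :: "complex set" and q f :: "complex poly" and n :: nat
  assumes "circular_domain D"
    and "lead_coeff q = 1"
    and "f \<noteq> 0" and "degree f = n"
  shows "(\<forall>u. S_op q n f u = Sym n (T_op q n f) u) \<and>
    ((\<forall>z. poly f z = 0 \<longrightarrow> z \<in> fibre_inside q D) \<longrightarrow>
       (\<forall>z. poly (T_op q n f) z = 0 \<longrightarrow> z \<in> poly q ` D) \<and>
       (\<forall>u. S_op q n f u = 0 \<longrightarrow> (\<exists>k\<in>{1..n}. u k \<in> poly q ` D))) \<and>
    ((\<forall>z\<in>poly q ` D. poly f z \<noteq> 0) \<longrightarrow>
       (\<forall>z\<in>fibre_inside q D. poly (T_op q n f) z \<noteq> 0) \<and>
       (\<forall>u. (\<forall>k\<in>{1..n}. u k \<in> fibre_inside q D) \<longrightarrow> S_op q n f u \<noteq> 0))"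
proof -
  let ?G = "\<lambda>u. \<Prod>j=1..n. q - [:u j:]"
  have D': "circular_domain (- D)"
    using assms(1) by (auto simp: circular_domain_def)
  have F: "degree (f \<circ>\<^sub>p q) = n * degree q"
    using assms(4) by (simp add: degree_pcompose)
  have root_G: "poly (?G u) z = 0 \<longleftrightarrow> (\<exists>k\<in>{1..n}. poly q z = u k)" for u z
    by (auto simp: poly_prod)
  have G: "degree (?G u) = n * degree q" if "?G u \<noteq> 0" for u
    using that by (subst degree_prod_eq_sum_degree) (auto simp: degree_minus_const)
  \<comment> \<open>If no u_k is in q(D), the zeros of \<open>?G u\<close> avoid D, while those of f
    o q lie in D because D contains the whole fibre over each zero of f.\<close>
  have zero: "\<exists>k\<in>{1..n}. u k \<in> poly q ` D"
    if f: "\<forall>z. poly f z = 0 \<longrightarrow> z \<in> fibre_inside q D" and S: "S_op q n f u = 0" for u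
  proof (rule ccontr)
    assume "\<not> ?thesis"
    then have out: "z \<notin> D" if "poly (?G u) z = 0" for z
      using that unfolding root_G by (metis image_eqI)
    have "?G u \<noteq> 0"
      using out circular_domain_proper(1)[OF assms(1)] by (metis all_not_in_conv poly_0)
    moreover have "z \<in> D" if "poly (f \<circ>\<^sub>p q) z = 0" for z
      using that f by (auto simp: poly_pcompose fibre_inside_def)
    ultimately have "S_op q n f u \<noteq> 0"
      unfolding S_op_eq_apolar_form using grace[OF assms(1) F G] out by blast
    with S show False by simp
  qed
  \<comment> \<open>Now the fibres over the u_k put the zeros of \<open>?G u\<close> in D and f o q
    has none there, so Grace's theorem is applied to the complement of D.\<close>
  have nonzero: "S_op q n f u \<noteq> 0"
    if f: "\<forall>z\<in>poly q ` D. poly f z \<noteq> 0" and u: "\<forall>k\<in>{1..n}. u k \<in> fibre_inside q D" for u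
  proof -
    have "z \<in> D" if "poly (?G u) z = 0" for z
      using that u unfolding root_G fibre_inside_def by blast
    moreover from this have "?G u \<noteq> 0"
      using circular_domain_proper(2)[OF assms(1)] by (metis UNIV_eq_I poly_0)
    moreover have "z \<in> - D" if "poly (f \<circ>\<^sub>p q) z = 0" for z
      using that f by (auto simp: poly_pcompose)
    ultimately show ?thesis
      unfolding S_op_eq_apolar_form using grace[OF D' F G] by blast
  qed
  show ?thesis
  proof (intro conjI allI impI ballI)
    show "S_op q n f u = Sym n (T_op q n f) u" for u
      by (rule S_op_eq_Sym)
    \<comment> \<open>The claims about T are those about S at a constant tuple.\<close>
    show "z \<in> poly q ` D"
      if "\<forall>z. poly f z = 0 \<longrightarrow> z \<in> fibre_inside q D" "poly (T_op q n f) z = 0" for z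
      using zero[of "\<lambda>_. z"] that by (simp add: poly_T_op)
    show "poly (T_op q n f) z \<noteq> 0"
      if "\<forall>z\<in>poly q ` D. poly f z \<noteq> 0" "z \<in> fibre_inside q D" for z
      using nonzero[of "\<lambda>_. z"] that by (simp add: poly_T_op)
    show "\<exists>k\<in>{1..n}. u k \<in> poly q ` D"
      if "\<forall>z. poly f z = 0 \<longrightarrow> z \<in> fibre_inside q D" "S_op q n f u = 0" for u
      by (rule zero[OF that])
    show "S_op q n f u \<noteq> 0"
      if "\<forall>z\<in>poly q ` D. poly f z \<noteq> 0" "\<forall>k\<in>{1..n}. u k \<in> fibre_inside q D" for u
      by (rule nonzero[OF that])
  qed
qed

end
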